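(* Let $k\ge1$ be an integer. If $\mathbb{S}_{k}$ is nonempty, then there is an integer $n>k$ such that for every integer $t\geq 1$ there is a graph $G$ of order $nt$ with $$\lambda_{k+1}(G)+\lambda_{k+1}(\overline{G})\geq\frac{nt}{\sqrt{2k}}-2$$ and $$|\lambda_{nt-k+1}(G)|+|\lambda_{nt-k+1}(\overline{G})|\geq\frac{nt}{\sqrt{2k}}.$$
   Context: Graphs are finite, simple and undirected; the order of a graph is its number of vertices, and $\overline{G}$ is the complement of $G$. For a graph $G$ of order $N$, $\lambda_1(G)\ge\cdots\ge\lambda_N(G)$ denote the eigenvalues of its adjacency matrix, with multiplicity. A $(-1,1)$-matrix is a matrix all of whose entries are $-1$ or $1$. For a real symmetric matrix $A$ of order $n(A)$, $\lambda_i^{\ast}(A)$ denotes its $i$'th largest singular value (the $i$'th largest absolute value of an eigenvalue). $\mathbb{S}_k$ is the set of all symmetric $(-1,1)$-matrices $A$, of any order $n(A)\ge k$, with $\lambda_k^{\ast}(A)=n(A)/\sqrt{k}$. *)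

theory Defs
  imports
    "HOL-Library.Multiset"
    "Jordan_Normal_Form.Char_Poly"
    "Graph_Theory.Pair_Digraph"
begin

section \<open>Finite simple undirected graphs\<close>

text \<open>
  A finite simple undirected graph is a \<^locale>\<open>pair_graph\<close>: a finite vertex set with a
  symmetric irreflexive set of arcs, each edge being represented by its two orientations.
\<close>

definition complement_graph :: "'a pair_pre_digraph \<Rightarrow> 'a pair_pre_digraph" where
  "complement_graph G =
     \<lparr> pverts = pverts G,
       parcs = {(u, v). u \<in> pverts G \<and> v \<in> pverts G \<and> u \<noteq> v \<and> (u, v) \<notin> parcs G} \<rparr>"

lemma pair_graph_complement_graph:
  assumes "pair_graph G"
  shows "pair_graph (complement_graph G)"
proof -
  interpret pair_graph G by fact
  have fin: "finite (parcs (complement_graph G))"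
    by (rule finite_subset[of _ "pverts G \<times> pverts G"]) (auto simp: complement_graph_def)
  show ?thesis
    using fin
    by unfold_locales
      (auto simp: complement_graph_def symmetric_def arcs_ends_def arc_to_ends_def
        intro!: symI intro: arcs_symmetric)
qed

definition graph_order :: "'a pair_pre_digraph \<Rightarrow> nat" where
  "graph_order G = card (pverts G)"

text \<open>
  The vertices are listed in increasing order; the spectrum does not depend on the listing.
\<close>

definition adjacency_matrix :: "('a :: linorder) pair_pre_digraph \<Rightarrow> real mat" where
  "adjacency_matrix G =
     (let vs = sorted_list_of_set (pverts G)
      in mat (graph_order G) (graph_order G)
           (\<lambda>(i, j). if (vs ! i, vs ! j) \<in> parcs G then 1 else 0))"

section \<open>Ordered eigenvalues and singular values\<close>

text \<open>
  The real roots of the characteristic polynomial with their multiplicities. For a real symmetric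
  matrix these are all the eigenvalues, so the multiset has as many elements as the matrix has rows.
\<close>

definition eigenvalue_mset :: "real mat \<Rightarrow> real multiset" where
  "eigenvalue_mset A = proots (char_poly A)"

text \<open>
  Indices start at 1. The values are meaningful for \<open>1 \<le> i \<le> size M\<close> only.
\<close>

definition nth_largest :: "nat \<Rightarrow> real multiset \<Rightarrow> real" where
  "nth_largest i M = rev (sorted_list_of_multiset M) ! (i - 1)"

definition graph_eigenvalue :: "nat \<Rightarrow> ('a :: linorder) pair_pre_digraph \<Rightarrow> real" where
  "graph_eigenvalue i G = nth_largest i (eigenvalue_mset (adjacency_matrix G))"

text \<open>
  Singular values as absolute values of eigenvalues: this is for symmetric matrices only.
\<close>

definition symmetric_singular_value :: "nat \<Rightarrow> real mat \<Rightarrow> real" where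
  "symmetric_singular_value i A = nth_largest i (image_mset abs (eigenvalue_mset A))"

definition sign_matrix :: "real mat \<Rightarrow> bool" where
  "sign_matrix A \<longleftrightarrow> elements_mat A \<subseteq> {-1, 1}"

definition extremal_sign_matrices :: "nat \<Rightarrow> real mat set" where
  "extremal_sign_matrices k =
     {A. square_mat A \<and> transpose_mat A = A \<and> sign_matrix A \<and> k \<le> dim_row A \<and>
         symmetric_singular_value k A = real (dim_row A) / sqrt (real k)}"

end

theory Submission
  imports
    Defs
    "Jordan_Normal_Form.Schur_Decomposition"
    "Jordan_Normal_Form.Spectral_Radius"
begin

text \<open>
  Let \<open>A\<close> be a symmetric sign matrix of order \<open>m\<close> whose \<open>k\<close>-th largest singular value is
  \<open>m / \<surd>k\<close>. It has \<open>k\<close> orthogonal eigenvectors with eigenvalues of absolute value at least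
  \<open>m / \<surd>k\<close>, but nothing is known about their signs. Take the Kronecker product
  \<open>B = A \<otimes> H \<otimes> a a\<^sup>T\<close>, where \<open>H\<close> is the Hadamard matrix of order 2 and \<open>a\<close> is the alternating
  vector of signs of length \<open>2 t\<close>. It is again a symmetric sign matrix; its order is \<open>N = 4 m t\<close>.

  The factor \<open>H\<close> has the eigenvalues \<open>\<surd>2\<close> and \<open>- \<surd>2\<close>, so each eigenvalue \<open>\<mu>\<close> of \<open>A\<close> yields both
  eigenvalues \<open>\<bar>\<mu>\<bar> \<surd>2 (2 t)\<close> and \<open>- \<bar>\<mu>\<bar> \<surd>2 (2 t)\<close> of \<open>B\<close>. With \<open>c = N / \<surd>(2 k)\<close>, which is
  \<open>(m / \<surd>k) \<surd>2 (2 t)\<close>, the matrix \<open>B\<close> therefore has \<open>k\<close> eigenvalues at least \<open>c\<close> and \<open>k\<close> eigenvalues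
  at most \<open>- c\<close>; see \<open>blow_up_eigenvectors\<close>. The factor \<open>a a\<^sup>T\<close> puts the all-ones vector into the
  kernel of \<open>B\<close>. So in \<open>J + B\<close>, where \<open>J\<close> is the all-ones matrix, these eigenvalues survive and the
  all-ones vector contributes one more eigenvalue \<open>N \<ge> c\<close>.

  Let \<open>G\<close> be the graph whose edges are the off-diagonal entries 1 of \<open>B\<close>. Twice its adjacency matrix
  is \<open>J + B\<close> minus a diagonal matrix with entries 0 and 2. By the Courant--Fischer principle
  (\<open>courant_fischer_count\<close>) this gives \<open>\<lambda>\<^bsub>k+1\<^esub>(G) \<ge> c / 2 - 1\<close> and \<open>\<lambda>\<^bsub>N-k+1\<^esub>(G) \<le> - c / 2\<close>;
  see \<open>sign_graph_eigenvalue_bounds\<close>. The complement of \<open>G\<close> belongs to \<open>- B\<close> in the same way, and \<open>- B\<close>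
  has the same properties as \<open>B\<close>, so the complement satisfies the same two bounds. Adding the bounds
  for \<open>G\<close> and its complement gives the claim.
\<close>

section \<open>The spectral theorem for real symmetric matrices\<close>

lemma real_scalar_prod_self_pos:
  fixes v :: "real vec"
  assumes "v \<in> carrier_vec n" "v \<noteq> 0\<^sub>v n"
  shows "v \<bullet> v > 0"
proof -
  have "conjugate v = v" by (rule eq_vecI) auto
  then have "v \<bullet> v \<noteq> 0" using conjugate_square_eq_0_vec[OF assms(1)] assms(2) by auto
  moreover have "v \<bullet> v \<ge> 0" by (auto simp: scalar_prod_def intro: sum_nonneg)
  ultimately show ?thesis by simp
qed

text \<open>
  The columns of \<open>U\<close> are an orthonormal eigenbasis. The matrix form, with the index of each
  eigenvalue kept in \<open>d\<close>, gives the eigenvalues with multiplicity and the diagonalized quadratic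
  form from one object.
\<close>

definition spectral_decomposition :: "nat \<Rightarrow> real mat \<Rightarrow> real mat \<Rightarrow> (nat \<Rightarrow> real) \<Rightarrow> bool" where
  "spectral_decomposition n A U d \<longleftrightarrow>
     U \<in> carrier_mat n n \<and> U\<^sup>T * U = 1\<^sub>m n \<and> A = U * mat_diag n d * U\<^sup>T"

text \<open>
  Over the complex numbers an eigenvalue \<open>a\<close> with eigenvector \<open>v\<close> exists. Symmetry of a real
  matrix gives \<open>a \<langle>v, v\<rangle> = \<langle>A v, v\<rangle> = \<langle>v, A v\<rangle> = cnj a \<langle>v, v\<rangle>\<close>, so \<open>a\<close> is real, and a real root
  of the characteristic polynomial is an eigenvalue of the real matrix.
\<close>

lemma real_symmetric_eigenvalue_exists:
  fixes A :: "real mat"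
  assumes A: "A \<in> carrier_mat n n" and sym: "A\<^sup>T = A" and n: "n > 0"
  shows "\<exists>e. eigenvalue A e"
proof -
  define C where "C = map_mat complex_of_real A"
  have C: "C \<in> carrier_mat n n" and C_sym: "C\<^sup>T = C"
    using A sym by (auto simp: C_def map_mat_transpose)
  obtain a where a: "eigenvalue C a"
    using spectrum_non_empty[OF C] n by (auto simp: spectrum_def)
  then obtain v where v: "v \<in> carrier_vec n" "v \<noteq> 0\<^sub>v n" "C *\<^sub>v v = a \<cdot>\<^sub>v v"
    using C by (auto simp: eigenvalue_def eigenvector_def)
  have conj_eigen: "C *\<^sub>v conjugate v = cnj a \<cdot>\<^sub>v conjugate v"
  proof (rule eq_vecI)
    fix i assume "i < dim_vec (cnj a \<cdot>\<^sub>v conjugate v)"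
    then have i: "i < n" using v by simp
    have "(C *\<^sub>v conjugate v) $ i = (\<Sum>j = 0..<n. C $$ (i, j) * cnj (v $ j))"
      using i C v by (auto simp: scalar_prod_def intro!: sum.cong)
    also have "\<dots> = cnj (\<Sum>j = 0..<n. C $$ (i, j) * v $ j)"
      using i A by (auto simp: C_def)
    also have "(\<Sum>j = 0..<n. C $$ (i, j) * v $ j) = (C *\<^sub>v v) $ i"
      using i C v(1) by (auto simp: scalar_prod_def intro!: sum.cong)
    also have "cnj \<dots> = (cnj a \<cdot>\<^sub>v conjugate v) $ i"
      using i v by simp
    finally show "(C *\<^sub>v conjugate v) $ i = (cnj a \<cdot>\<^sub>v conjugate v) $ i" .
  qed (use C v in auto)
  have cv: "conjugate v \<in> carrier_vec n" using v by simp
  have "a * (v \<bullet>c v) = (C *\<^sub>v v) \<bullet>c v"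
    using v cv by simp
  also have "\<dots> = (C\<^sup>T *\<^sub>v v) \<bullet>c v" using C_sym by simp
  also have "\<dots> = v \<bullet> (C *\<^sub>v conjugate v)"
    by (rule transpose_vec_mult_scalar[OF C cv v(1)])
  also have "\<dots> = cnj a * (v \<bullet>c v)"
    unfolding conj_eigen using v cv by simp
  finally have "a = cnj a"
    using conjugate_square_eq_0_vec[OF v(1)] v(2) by auto
  then have "a = complex_of_real (Re a)" by (simp add: complex_eq_iff)
  moreover have "poly (char_poly C) a = 0"
    using a eigenvalue_root_char_poly[OF C] by simp
  ultimately have "poly (map_poly complex_of_real (char_poly A)) (complex_of_real (Re a)) = 0"
    using of_real_hom.char_poly_hom[OF A, where 'a=complex] by (simp add: C_def)
  then have "poly (char_poly A) (Re a) = 0"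
    by simp
  then show ?thesis
    using eigenvalue_root_char_poly[OF A] by blast
qed

text \<open>
  Gram--Schmidt, applied to a basis that starts with \<open>v\<close>, keeps \<open>v\<close> as its first vector; the
  other vectors only need to be normalized.
\<close>

lemma orthogonal_matrix_with_first_column:
  fixes v :: "real vec"
  assumes v: "v \<in> carrier_vec n" and unit: "v \<bullet> v = 1"
  shows "\<exists>U \<in> carrier_mat n n. U\<^sup>T * U = 1\<^sub>m n \<and> col U 0 = v"
proof -
  have v0: "v \<noteq> 0\<^sub>v n" using unit by auto
  have n: "n > 0" using v v0 by (cases n) auto
  interpret cof_vec_space n "TYPE(real)" .
  define b where "b = basis_completion v"
  define ws where "ws = gram_schmidt n b"
  note b = basis_completion[OF v v0, folded b_def]
  obtain vs where bv: "b = v # vs" using b(6,7) n by (cases b) auto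
  note gs = gram_schmidt_result[OF b(2,4,5) refl, folded ws_def]
  have hd_ws: "hd ws = v" using gram_schmidt_hd[OF v, of vs] bv by (simp add: ws_def)
  have len: "length ws = n" using gs(4) b(6) by simp
  then have ws0: "ws ! 0 = v" using hd_ws n by (cases ws) auto
  have wsi: "ws ! i \<in> carrier_vec n" if "i < n" for i using gs(3) len that by auto
  have orth: "(ws ! i \<bullet> ws ! j = 0) = (i \<noteq> j)" if "i < n" "j < n" for i j
  proof -
    have "conjugate (ws ! j) = ws ! j" by (rule eq_vecI) auto
    then show ?thesis using corthogonalD[OF gs(2), of i j] len that by auto
  qed
  define u where "u i = (1 / sqrt (ws ! i \<bullet> ws ! i)) \<cdot>\<^sub>v (ws ! i)" for i
  have u: "u i \<in> carrier_vec n" if "i < n" for i using wsi[OF that] by (simp add: u_def)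
  have uu: "u i \<bullet> u j = (if i = j then 1 else 0)" if "i < n" "j < n" for i j
  proof -
    have "ws ! i \<bullet> ws ! i \<ge> 0" by (auto simp: scalar_prod_def intro: sum_nonneg)
    then show ?thesis
      using orth[OF that] wsi[OF that(1)] wsi[OF that(2)] by (auto simp: u_def)
  qed
  define U where "U = mat_of_cols n (map u [0..<n])"
  have U: "U \<in> carrier_mat n n" by (simp add: U_def mat_of_cols_def)
  have col_U: "col U i = u i" if "i < n" for i
    using that u[OF that] by (simp add: U_def)
  have "U\<^sup>T * U = 1\<^sub>m n"
    by (rule eq_matI) (use U in \<open>auto simp: col_U uu\<close>)
  moreover have "col U 0 = v"
    using n ws0 unit v by (simp add: col_U u_def)
  ultimately show ?thesis using U by blast
qed

text \<open>
  Induction on the order by deflation. An orthogonal change of basis that makes a unit eigenvector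
  the first basis vector turns the first column of \<open>A\<close> into a multiple of the first unit vector.
  By symmetry the first row has the same form, so a symmetric block of order one less is left.
\<close>

theorem real_spectral_theorem:
  assumes "A \<in> carrier_mat n n" "A\<^sup>T = A"
  shows "\<exists>U d. spectral_decomposition n A U d"
  using assms
proof (induction n arbitrary: A)
  case 0
  then have "spectral_decomposition 0 A (1\<^sub>m 0) (\<lambda>_. 0)"
    by (auto simp: spectral_decomposition_def intro!: eq_matI)
  then show ?case by blast
next
  case (Suc m)
  let ?n = "Suc m"
  note A = Suc.prems(1) and sym = Suc.prems(2)
  obtain e w where w: "w \<in> carrier_vec ?n" "w \<noteq> 0\<^sub>v ?n" "A *\<^sub>v w = e \<cdot>\<^sub>v w"
    using real_symmetric_eigenvalue_exists[OF A sym] A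
    by (auto simp: eigenvalue_def eigenvector_def)
  have "w \<bullet> w > 0" by (rule real_scalar_prod_self_pos[OF w(1,2)])
  define v where "v = (1 / sqrt (w \<bullet> w)) \<cdot>\<^sub>v w"
  have v: "v \<in> carrier_vec ?n" "v \<bullet> v = 1" "A *\<^sub>v v = e \<cdot>\<^sub>v v"
    using w \<open>w \<bullet> w > 0\<close> A by (auto simp: v_def mult_mat_vec smult_smult_assoc mult.commute)
  obtain W where W: "W \<in> carrier_mat ?n ?n" "W\<^sup>T * W = 1\<^sub>m ?n" "col W 0 = v"
    using orthogonal_matrix_with_first_column[OF v(1,2)] by blast
  have WWT: "W * W\<^sup>T = 1\<^sub>m ?n"
    using mat_mult_left_right_inverse[OF _ W(1) W(2)] W(1) by simp
  define A' where "A' = W\<^sup>T * A * W"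
  have A': "A' \<in> carrier_mat ?n ?n" using A W by (auto simp: A'_def)
  have A'_sym: "A'\<^sup>T = A'"
    using A W sym by (simp add: A'_def transpose_mult[of _ ?n ?n _ ?n] assoc_mult_mat[of _ ?n ?n _ ?n _ ?n])
  have A_eq: "A = W * A' * W\<^sup>T"
  proof -
    have "W * A' * W\<^sup>T = (W * W\<^sup>T) * A * (W * W\<^sup>T)"
      using A W(1) by (simp add: A'_def assoc_mult_mat[of _ ?n ?n _ ?n _ ?n])
    then show ?thesis using A WWT by simp
  qed
  have col0: "A' $$ (i, 0) = (if i = 0 then e else 0)" if "i < ?n" for i
  proof -
    have "A' $$ (i, 0) = row (W\<^sup>T) i \<bullet> col (A * W) 0"
      using that A W(1) by (simp add: A'_def assoc_mult_mat[of _ ?n ?n _ ?n _ ?n])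
    also have "col (A * W) 0 = A *\<^sub>v v"
      using A W(1,3) by (metis col_mult2 zero_less_Suc)
    also have "row (W\<^sup>T) i \<bullet> (A *\<^sub>v v) = e * (row (W\<^sup>T) i \<bullet> col W 0)"
      unfolding v(3) W(3) using that v(1) W(1) by (auto intro!: scalar_prod_smult_distrib)
    also have "row (W\<^sup>T) i \<bullet> col W 0 = (W\<^sup>T * W) $$ (i, 0)"
      using that W(1) by simp
    finally show ?thesis using that unfolding W(2) by simp
  qed
  have row0: "A' $$ (0, j) = (if j = 0 then e else 0)" if "j < ?n" for j
    using col0[OF that] A' that arg_cong[OF A'_sym, of "\<lambda>M. M $$ (j, 0)"] by simp
  define A3 where "A3 = mat m m (\<lambda>(i, j). A' $$ (Suc i, Suc j))"
  have A3: "A3 \<in> carrier_mat m m" by (simp add: A3_def)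
  have "A3\<^sup>T = A3"
  proof (rule eq_matI)
    fix i j assume "i < dim_row A3" "j < dim_col A3"
    then show "A3\<^sup>T $$ (i, j) = A3 $$ (i, j)"
      using A' arg_cong[OF A'_sym, of "\<lambda>M. M $$ (Suc i, Suc j)"] by (simp add: A3_def)
  qed (use A3 in auto)
  then obtain V d where "spectral_decomposition m A3 V d"
    using Suc.IH[OF A3] by blast
  then have V: "V \<in> carrier_mat m m" "V\<^sup>T * V = 1\<^sub>m m" and A3_eq: "A3 = V * mat_diag m d * V\<^sup>T"
    by (auto simp: spectral_decomposition_def)
  let ?Z = "0\<^sub>m 1 m :: real mat" and ?Z' = "0\<^sub>m m 1 :: real mat"
  define P where "P = four_block_mat (1\<^sub>m 1) ?Z ?Z' V"
  define d' where "d' i = (case i of 0 \<Rightarrow> e | Suc j \<Rightarrow> d j)" for i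
  let ?E = "mat 1 1 (\<lambda>_. e)"
  have P: "P \<in> carrier_mat ?n ?n"
    using V(1) four_block_carrier_mat[of "1\<^sub>m 1" 1 1 V m m] by (simp add: P_def)
  have PT: "P\<^sup>T = four_block_mat (1\<^sub>m 1) ?Z ?Z' (V\<^sup>T)"
    unfolding P_def by (subst transpose_four_block_mat[of _ 1 1 _ m _ m]) (use V(1) in auto)
  have diag: "mat_diag ?n d' = four_block_mat ?E ?Z ?Z' (mat_diag m d)"
    by (rule eq_matI) (auto simp: mat_diag_def d'_def split: nat.split)
  have A'_block: "A' = four_block_mat ?E ?Z ?Z' A3"
  proof (rule eq_matI)
    fix i j
    assume "i < dim_row (four_block_mat ?E ?Z ?Z' A3)" "j < dim_col (four_block_mat ?E ?Z ?Z' A3)"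
    then have "i < ?n" "j < ?n" using A3 by auto
    then show "A' $$ (i, j) = four_block_mat ?E ?Z ?Z' A3 $$ (i, j)"
      using col0 row0 A3 by (cases i; cases j) (auto simp: A3_def)
  qed (use A' A3 in auto)
  have PTP: "P\<^sup>T * P = 1\<^sub>m ?n"
    unfolding PT unfolding P_def
    by (subst mult_four_block_mat[of _ 1 1 _ m _ m _ _ 1 _ m]) (use V in auto)
  have VD: "V * mat_diag m d \<in> carrier_mat m m"
    using V(1) by (rule mult_carrier_mat) simp
  have VDV: "V * mat_diag m d * V\<^sup>T \<in> carrier_mat m m"
    by (rule mult_carrier_mat[OF VD]) (use V(1) in simp)
  have PDP: "P * mat_diag ?n d' * P\<^sup>T = A'"
  proof -
    have "P * mat_diag ?n d' = four_block_mat ?E ?Z ?Z' (V * mat_diag m d)"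
      unfolding P_def diag
      by (subst mult_four_block_mat[of _ 1 1 _ m _ m _ _ 1 _ m]) (use V(1) in \<open>auto simp: left_mult_zero_mat[OF mat_diag_dim]\<close>)
    also have "\<dots> * P\<^sup>T = four_block_mat ?E ?Z ?Z' (V * mat_diag m d * V\<^sup>T)"
      unfolding PT
      by (subst mult_four_block_mat[of _ 1 1 _ m _ m _ _ 1 _ m]) (use V(1) VD VDV in \<open>auto simp: right_mult_zero_mat[OF VD] left_add_zero_mat[OF VDV]\<close>)
    finally show ?thesis unfolding A'_block A3_eq .
  qed
  have D: "mat_diag ?n d' \<in> carrier_mat ?n ?n" by simp
  define U where "U = W * P"
  have U: "U \<in> carrier_mat ?n ?n" using W(1) P by (simp add: U_def)
  have "U\<^sup>T * U = P\<^sup>T * (W\<^sup>T * W) * P"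
    using W(1) P by (simp add: U_def transpose_mult[of _ ?n ?n _ ?n] assoc_mult_mat[of _ ?n ?n _ ?n _ ?n])
  then have "U\<^sup>T * U = 1\<^sub>m ?n" using W(2) PTP P by simp
  moreover have "A = U * mat_diag ?n d' * U\<^sup>T"
    unfolding A_eq PDP[symmetric] using W(1) P D
    by (simp add: U_def transpose_mult[of _ ?n ?n _ ?n] assoc_mult_mat[of _ ?n ?n _ ?n _ ?n]
      mult_carrier_mat[of _ ?n ?n _ ?n])
  ultimately have "spectral_decomposition ?n A U d'"
    using U by (simp add: spectral_decomposition_def)
  then show ?case by blast
qed

lemma eigenvalue_mset_spectral_decomposition:
  assumes "spectral_decomposition n A U d"
  shows "eigenvalue_mset A = image_mset d (mset_set {..<n})"
proof -
  have U: "U \<in> carrier_mat n n" and UTU: "U\<^sup>T * U = 1\<^sub>m n" and A: "A = U * mat_diag n d * U\<^sup>T"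
    using assms by (auto simp: spectral_decomposition_def)
  have UUT: "U * U\<^sup>T = 1\<^sub>m n"
    using mat_mult_left_right_inverse[OF _ U UTU] U by simp
  have "similar_mat A (mat_diag n d)"
    by (rule similar_matI[of _ _ U "U\<^sup>T" n]) (use U UTU UUT A in auto)
  then have "char_poly A = char_poly (mat_diag n d)"
    by (rule char_poly_similar)
  also have "\<dots> = (\<Prod>a\<leftarrow>diag_mat (mat_diag n d). [:- a, 1:])"
    by (rule char_poly_upper_triangular[of _ n]) (auto simp: mat_diag_def)
  also have "diag_mat (mat_diag n d) = map d [0..<n]"
    by (auto simp: diag_mat_def mat_diag_def)
  also have "(\<Prod>a\<leftarrow>map d [0..<n]. [:- a, 1:]) = (\<Prod>i<n. [:- d i, 1:])"
    by (simp add: prod.list_conv_set_nth atLeast0LessThan)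
  finally have "eigenvalue_mset A = (\<Sum>i<n. {#d i#})"
    by (simp add: eigenvalue_mset_def proots_prod)
  also have "\<dots> = image_mset d (mset_set {..<n})"
    by (induction n) (auto simp: lessThan_Suc)
  finally show ?thesis .
qed

definition orthogonal_eigenvectors ::
  "nat \<Rightarrow> real mat \<Rightarrow> nat \<Rightarrow> (nat \<Rightarrow> real vec) \<Rightarrow> (nat \<Rightarrow> real) \<Rightarrow> bool" where
  "orthogonal_eigenvectors n E r w \<mu> \<longleftrightarrow>
     (\<forall>i<r. w i \<in> carrier_vec n \<and> w i \<noteq> 0\<^sub>v n \<and> E *\<^sub>v w i = \<mu> i \<cdot>\<^sub>v w i) \<and>
     (\<forall>i<r. \<forall>j<r. i \<noteq> j \<longrightarrow> w i \<bullet> w j = 0)"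

lemma spectral_decomposition_uminus:
  assumes "spectral_decomposition n A U d"
  shows "spectral_decomposition n (- A) U (\<lambda>i. - d i)"
proof -
  have U: "U \<in> carrier_mat n n" and "U\<^sup>T * U = 1\<^sub>m n" and A: "A = U * mat_diag n d * U\<^sup>T"
    using assms by (auto simp: spectral_decomposition_def)
  moreover have "- A = U * mat_diag n (\<lambda>i. - d i) * U\<^sup>T"
    unfolding A mat_diag_mult_right[OF U]
    by (rule eq_matI) (use U in \<open>auto simp: scalar_prod_def sum_negf[symmetric]\<close>)
  ultimately show ?thesis by (simp add: spectral_decomposition_def)
qed

lemma spectral_decomposition_eigenvectors:
  assumes "spectral_decomposition n A U d"
  shows "orthogonal_eigenvectors n A n (col U) d"
proof -
  have U: "U \<in> carrier_mat n n" and UTU: "U\<^sup>T * U = 1\<^sub>m n" and A: "A = U * mat_diag n d * U\<^sup>T"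
    using assms by (auto simp: spectral_decomposition_def)
  have carrier: "A \<in> carrier_mat n n" using U by (auto simp: A)
  have D: "mat_diag n d \<in> carrier_mat n n" by simp
  have orth: "col U i \<bullet> col U j = (if i = j then 1 else 0)" if "i < n" "j < n" for i j
  proof -
    have "col U i \<bullet> col U j = (U\<^sup>T * U) $$ (i, j)" using U that by simp
    then show ?thesis using that by (simp add: UTU)
  qed
  have "A * U = U * mat_diag n d * (U\<^sup>T * U)"
    unfolding A by (rule assoc_mult_mat[OF mult_carrier_mat[OF U D] _ U]) (use U in simp)
  then have AU: "A * U = U * mat_diag n d"
    using U D by (simp add: UTU right_mult_one_mat[OF mult_carrier_mat[OF U D]])
  have "A *\<^sub>v col U i = d i \<cdot>\<^sub>v col U i" if i: "i < n" for i
  proof -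
    have "A *\<^sub>v col U i = col (A * U) i" by (rule col_mult2[OF carrier U i, symmetric])
    also have "\<dots> = d i \<cdot>\<^sub>v col U i"
      unfolding AU mat_diag_mult_right[OF U] by (rule eq_vecI) (use U i in auto)
    finally show ?thesis .
  qed
  moreover have "col U i \<noteq> 0\<^sub>v n" if "i < n" for i
    using orth[OF that that] U by auto
  ultimately show ?thesis
    using U orth by (auto simp: orthogonal_eigenvectors_def)
qed

lemma orthogonal_eigenvectors_uminus:
  assumes "orthogonal_eigenvectors n E r w \<mu>" "E \<in> carrier_mat n n"
  shows "orthogonal_eigenvectors n (- E) r w (\<lambda>i. - \<mu> i)"
  using assms by (auto simp: orthogonal_eigenvectors_def)

section \<open>The Courant--Fischer principle\<close>

lemma mat_diag_mult_vec:
  fixes f :: "nat \<Rightarrow> 'a :: comm_semiring_1"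
  assumes a: "a \<in> carrier_vec n"
  shows "mat_diag n f *\<^sub>v a = vec n (\<lambda>i. f i * a $ i)"
proof (rule eq_vecI)
  fix i assume "i < dim_vec (vec n (\<lambda>i. f i * a $ i))"
  then have i: "i < n" by simp
  have "row (mat_diag n f) i = f i \<cdot>\<^sub>v unit_vec n i"
    by (rule eq_vecI) (use i in \<open>auto simp: mat_diag_def\<close>)
  then show "(mat_diag n f *\<^sub>v a) $ i = vec n (\<lambda>i. f i * a $ i) $ i"
    using i a by (simp add: mat_diag_def)
qed (simp add: mat_diag_def)

text \<open>
  Padding with zero equations makes the system square, and a matrix with a zero row is singular.
\<close>

lemma underdetermined_system_nontrivial_solution:
  fixes M :: "nat \<Rightarrow> nat \<Rightarrow> real"
  assumes J: "finite J" "card J < r"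
  shows "\<exists>a \<in> carrier_vec r. a \<noteq> 0\<^sub>v r \<and> (\<forall>j\<in>J. (\<Sum>i<r. M j i * a $ i) = 0)"
proof -
  obtain js where js: "set js = J" "length js = card J"
    using finite_distinct_list[OF J(1)] distinct_card by metis
  define A where "A = mat r r (\<lambda>(p, i). if p < card J then M (js ! p) i else 0)"
  have A: "A \<in> carrier_mat r r" by (simp add: A_def)
  have "row A (r - 1) = 0\<^sub>v r"
    by (rule eq_vecI) (use J in \<open>auto simp: A_def\<close>)
  then have A_eq: "A = mat\<^sub>r r r (\<lambda>i. if i = r - 1 then 0\<^sub>v r else row A i)"
    by (intro eq_rowI) (use A in auto)
  have "r - 1 < r" using J by simp
  then have "det (mat\<^sub>r r r (\<lambda>i. if i = r - 1 then 0\<^sub>v r else row A i)) = 0"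
    by (rule det_row_0) (use A in auto)
  then have "det A = 0" by (simp only: A_eq[symmetric])
  then obtain a where a: "a \<in> carrier_vec r" "a \<noteq> 0\<^sub>v r" "A *\<^sub>v a = 0\<^sub>v r"
    using det_0_iff_vec_prod_zero[OF A] by blast
  have "(\<Sum>i<r. M j i * a $ i) = 0" if "j \<in> J" for j
  proof -
    have "j \<in> set js" using that js(1) by simp
    then obtain p where p: "p < card J" "js ! p = j"
      unfolding in_set_conv_nth js(2) by blast
    have "(\<Sum>i<r. M j i * a $ i) = (A *\<^sub>v a) $ p"
      using p J a(1) by (auto simp: A_def scalar_prod_def atLeast0LessThan intro!: sum.cong)
    then show ?thesis using a(3) p J by simp
  qed
  then show ?thesis using a by blast
qed

text \<open>
  The Courant--Fischer principle as a statement about counting: if the quadratic form of \<open>A\<close> is at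
  least \<open>c \<parallel>x\<parallel>\<^sup>2\<close> on a subspace of dimension \<open>r\<close>, here the range of the injective matrix \<open>W\<close>, then
  at least \<open>r\<close> eigenvalues are at least \<open>c\<close>. Otherwise some nonzero \<open>x\<close> of the subspace is
  orthogonal to all the eigenvectors for eigenvalues at least \<open>c\<close>, as these are fewer than \<open>r\<close>
  linear conditions. Such an \<open>x\<close> is a combination of the other eigenvectors, and there the
  form is less than \<open>c \<parallel>x\<parallel>\<^sup>2\<close>.
\<close>

lemma courant_fischer_count:
  assumes spec: "spectral_decomposition n A U d"
    and W: "W \<in> carrier_mat n r"
    and inj: "\<And>a. a \<in> carrier_vec r \<Longrightarrow> a \<noteq> 0\<^sub>v r \<Longrightarrow> W *\<^sub>v a \<noteq> 0\<^sub>v n"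
    and quad: "\<And>a. a \<in> carrier_vec r \<Longrightarrow>
      c * ((W *\<^sub>v a) \<bullet> (W *\<^sub>v a)) \<le> (W *\<^sub>v a) \<bullet> (A *\<^sub>v (W *\<^sub>v a))"
  shows "r \<le> card {i. i < n \<and> c \<le> d i}"
proof (rule ccontr)
  let ?J = "{i. i < n \<and> c \<le> d i}"
  assume "\<not> r \<le> card ?J"
  then have small: "card ?J < r" by simp
  have U: "U \<in> carrier_mat n n" and UTU: "U\<^sup>T * U = 1\<^sub>m n" and A: "A = U * mat_diag n d * U\<^sup>T"
    using spec by (auto simp: spectral_decomposition_def)
  have UUT: "U * U\<^sup>T = 1\<^sub>m n"
    using mat_mult_left_right_inverse[OF _ U UTU] U by simp
  \<comment> \<open>Row \<open>j\<close> of \<open>M\<close> maps the coefficients \<open>a\<close> of \<open>x = W a\<close> to the \<open>j\<close>-th coordinate \<open>y\<^sub>j\<close> of \<open>x\<close> in the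
      eigenbasis.\<close>
  define M where "M = U\<^sup>T * W"
  have M: "M \<in> carrier_mat n r" using U W by (simp add: M_def)
  obtain a where a: "a \<in> carrier_vec r" "a \<noteq> 0\<^sub>v r" and
    zero: "\<And>j. j \<in> ?J \<Longrightarrow> (\<Sum>i<r. M $$ (j, i) * a $ i) = 0"
    using underdetermined_system_nontrivial_solution[OF _ small, of "\<lambda>j i. M $$ (j, i)"] by auto
  define x where "x = W *\<^sub>v a"
  define y where "y = U\<^sup>T *\<^sub>v x"
  have x: "x \<in> carrier_vec n" "x \<noteq> 0\<^sub>v n" using W a inj by (auto simp: x_def)
  have y: "y \<in> carrier_vec n" using U x by (simp add: y_def)
  have x_eq: "x = U *\<^sub>v y"
    using U x UUT by (simp add: y_def assoc_mult_mat_vec[symmetric, of _ n n _ n])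
  have y_zero: "y $ j = 0" if "j \<in> ?J" for j
  proof -
    have "y = M *\<^sub>v a" using U W a by (simp add: y_def x_def M_def)
    then show ?thesis
      using zero[OF that] that M a(1) by (simp add: scalar_prod_def atLeast0LessThan)
  qed
  have xx: "x \<bullet> x = (\<Sum>i<n. y $ i * y $ i)"
  proof -
    have "x \<bullet> x = y \<bullet> (U\<^sup>T *\<^sub>v x)"
      using transpose_vec_mult_scalar[of "U\<^sup>T" n n x y] U x y x_eq by simp
    then show ?thesis
      unfolding y_def[symmetric] using y by (simp add: scalar_prod_def atLeast0LessThan)
  qed
  have xAx: "x \<bullet> (A *\<^sub>v x) = (\<Sum>i<n. d i * (y $ i * y $ i))"
  proof -
    have D: "mat_diag n d \<in> carrier_mat n n" by simp
    have "A *\<^sub>v x = U *\<^sub>v (mat_diag n d *\<^sub>v y)"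
      using U x D by (simp add: A y_def assoc_mult_mat_vec[of _ n n _ n])
    then have "x \<bullet> (A *\<^sub>v x) = y \<bullet> (mat_diag n d *\<^sub>v y)"
      using transpose_vec_mult_scalar[of U n n "mat_diag n d *\<^sub>v y" x] U x y D
      by (simp add: y_def)
    then show ?thesis
      using y by (simp add: mat_diag_mult_vec scalar_prod_def atLeast0LessThan mult_ac)
  qed
  have "\<exists>i<n. y $ i \<noteq> 0"
  proof (rule ccontr)
    assume "\<not> ?thesis"
    then have "y = 0\<^sub>v n" using y by (intro eq_vecI) auto
    then have "x = 0\<^sub>v n" using x_eq U by (intro eq_vecI) auto
    then show False using x by simp
  qed
  then obtain i where i: "i < n" "y $ i \<noteq> 0" by blast
  have "x \<bullet> (A *\<^sub>v x) < (\<Sum>i<n. c * (y $ i * y $ i))"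
    unfolding xAx
  proof (rule sum_strict_mono_ex1)
    show "\<forall>j\<in>{..<n}. d j * (y $ j * y $ j) \<le> c * (y $ j * y $ j)"
    proof
      fix j assume "j \<in> {..<n}"
      then show "d j * (y $ j * y $ j) \<le> c * (y $ j * y $ j)"
        using y_zero[of j] by (cases "c \<le> d j") (auto intro: mult_right_mono)
    qed
    have "d i < c" using y_zero[of i] i by (auto simp: not_le[symmetric])
    moreover have "y $ i * y $ i > 0" using i(2) by (metis not_real_square_gt_zero)
    ultimately have "d i * (y $ i * y $ i) < c * (y $ i * y $ i)"
      by (rule mult_strict_right_mono)
    then show "\<exists>j\<in>{..<n}. d j * (y $ j * y $ j) < c * (y $ j * y $ j)"
      using i(1) by auto
  qed simp
  also have "\<dots> = c * (x \<bullet> x)" by (simp add: xx sum_distrib_left)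
  finally show False using quad[OF a(1)] by (simp add: x_def)
qed

text \<open>
  The form in which Courant--Fischer is used: the test subspace is spanned by eigenvectors of a
  comparison matrix \<open>E\<close> whose quadratic form exceeds that of \<open>A\<close> by at most \<open>\<delta> \<parallel>x\<parallel>\<^sup>2\<close>.
\<close>

lemma eigenvalue_count_lower_bound:
  assumes spec: "spectral_decomposition n A U d"
    and E: "E \<in> carrier_mat n n"
    and ev: "orthogonal_eigenvectors n E r w \<mu>"
    and \<mu>: "\<And>i. i < r \<Longrightarrow> c \<le> \<mu> i"
    and dominates: "\<And>x. x \<in> carrier_vec n \<Longrightarrow> x \<bullet> (E *\<^sub>v x) - \<delta> * (x \<bullet> x) \<le> x \<bullet> (A *\<^sub>v x)"
  shows "r \<le> card {i. i < n \<and> c - \<delta> \<le> d i}"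
proof -
  have w: "w i \<in> carrier_vec n" "w i \<noteq> 0\<^sub>v n" "E *\<^sub>v w i = \<mu> i \<cdot>\<^sub>v w i" if "i < r" for i
    using ev that by (auto simp: orthogonal_eigenvectors_def)
  have orth: "w i \<bullet> w j = 0" if "i < r" "j < r" "i \<noteq> j" for i j
    using ev that by (auto simp: orthogonal_eigenvectors_def)
  have pos: "w i \<bullet> w i > 0" if "i < r" for i
    using real_scalar_prod_self_pos w[OF that] by blast
  define W where "W = mat n r (\<lambda>(p, i). w i $ p)"
  have W: "W \<in> carrier_mat n r" by (simp add: W_def)
  have col_W: "col W i = w i" if "i < r" for i
    using that w(1)[OF that] by (auto simp: W_def)
  \<comment> \<open>In the coordinates \<open>a\<close> of \<open>x = W a\<close>, both \<open>\<parallel>x\<parallel>\<^sup>2\<close> and the form of \<open>E\<close> are diagonal.\<close>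
  have EW: "E * W = W * mat_diag r \<mu>"
  proof (rule eq_matI)
    fix p i assume "p < dim_row (W * mat_diag r \<mu>)" "i < dim_col (W * mat_diag r \<mu>)"
    then have p: "p < n" and i: "i < r" using W by (auto simp: mat_diag_def)
    have "(E * W) $$ (p, i) = (E *\<^sub>v w i) $ p" using p i E W by (simp add: col_W)
    also have "\<dots> = \<mu> i * w i $ p" using w[OF i] p by simp
    finally show "(E * W) $$ (p, i) = (W * mat_diag r \<mu>) $$ (p, i)"
      using p i by (subst mat_diag_mult_right[OF W]) (simp add: W_def)
  qed (use E W in \<open>auto simp: mat_diag_def\<close>)
  have WTW: "W\<^sup>T * W = mat_diag r (\<lambda>i. w i \<bullet> w i)"
    by (rule eq_matI) (use W orth in \<open>auto simp: mat_diag_def col_W\<close>)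
  have diag_form: "a \<bullet> (mat_diag r f *\<^sub>v a) = (\<Sum>i<r. f i * (a $ i * a $ i))"
    if a: "a \<in> carrier_vec r" for f and a :: "real vec"
    using a by (simp add: mat_diag_mult_vec scalar_prod_def atLeast0LessThan mult_ac)
  have D: "mat_diag r f \<in> carrier_mat r r" for f :: "nat \<Rightarrow> real" by simp
  have xx: "(W *\<^sub>v a) \<bullet> (W *\<^sub>v a) = (\<Sum>i<r. (w i \<bullet> w i) * (a $ i * a $ i))"
    if a: "a \<in> carrier_vec r" for a
  proof -
    have "(W *\<^sub>v a) \<bullet> (W *\<^sub>v a) = a \<bullet> (W\<^sup>T *\<^sub>v (W *\<^sub>v a))"
      using transpose_vec_mult_scalar[of "W\<^sup>T" r n "W *\<^sub>v a" a] W a by simp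
    also have "W\<^sup>T *\<^sub>v (W *\<^sub>v a) = (W\<^sup>T * W) *\<^sub>v a"
      using W a by (simp add: assoc_mult_mat_vec[of _ r n _ r])
    finally show ?thesis unfolding WTW diag_form[OF a] .
  qed
  have xEx: "(W *\<^sub>v a) \<bullet> (E *\<^sub>v (W *\<^sub>v a)) = (\<Sum>i<r. \<mu> i * ((w i \<bullet> w i) * (a $ i * a $ i)))"
    if a: "a \<in> carrier_vec r" for a
  proof -
    define z where "z = mat_diag r \<mu> *\<^sub>v a"
    have z: "z \<in> carrier_vec r" unfolding z_def by (rule mult_mat_vec_carrier[OF D a])
    have WT: "W\<^sup>T \<in> carrier_mat r n" using W by simp
    have "E *\<^sub>v (W *\<^sub>v a) = (E * W) *\<^sub>v a"
      by (rule assoc_mult_mat_vec[OF E W a, symmetric])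
    also have "\<dots> = W *\<^sub>v z"
      unfolding EW z_def by (rule assoc_mult_mat_vec[OF W D a])
    finally have "(W *\<^sub>v a) \<bullet> (E *\<^sub>v (W *\<^sub>v a)) = a \<bullet> (W\<^sup>T *\<^sub>v (W *\<^sub>v z))"
      using transpose_vec_mult_scalar[OF WT mult_mat_vec_carrier[OF W z] a] by simp
    also have "W\<^sup>T *\<^sub>v (W *\<^sub>v z) = (W\<^sup>T * W) *\<^sub>v z"
      by (rule assoc_mult_mat_vec[OF WT W z, symmetric])
    also have "\<dots> = (W\<^sup>T * W * mat_diag r \<mu>) *\<^sub>v a"
      unfolding z_def by (rule assoc_mult_mat_vec[OF mult_carrier_mat[OF WT W] D a, symmetric])
    also have "a \<bullet> \<dots> = (\<Sum>i<r. ((w i \<bullet> w i) * \<mu> i) * (a $ i * a $ i))"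
      unfolding WTW mat_diag_diag by (rule diag_form[OF a])
    finally show ?thesis by (simp add: mult_ac)
  qed
  show ?thesis
  proof (rule courant_fischer_count[OF spec W])
    fix a :: "real vec" assume a: "a \<in> carrier_vec r"
    show "W *\<^sub>v a \<noteq> 0\<^sub>v n" if nz: "a \<noteq> 0\<^sub>v r"
    proof
      assume "W *\<^sub>v a = 0\<^sub>v n"
      then have "(\<Sum>i<r. (w i \<bullet> w i) * (a $ i * a $ i)) = 0"
        using xx[OF a] by simp
      then have "\<forall>i\<in>{..<r}. (w i \<bullet> w i) * (a $ i * a $ i) = 0"
        by (subst (asm) sum_nonneg_eq_0_iff) (use pos in \<open>auto intro!: mult_nonneg_nonneg simp: less_imp_le\<close>)
      note zero = this
      have "a $ i = 0" if "i < r" for i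
        using bspec[OF zero, of i] pos[OF that] that by auto
      then have "a = 0\<^sub>v r" using a by (intro eq_vecI) auto
      then show False using nz by simp
    qed
    let ?x = "W *\<^sub>v a"
    have "c * (?x \<bullet> ?x) \<le> ?x \<bullet> (E *\<^sub>v ?x)"
      unfolding xx[OF a] xEx[OF a] sum_distrib_left
    proof (rule sum_mono)
      fix i assume "i \<in> {..<r}"
      then have i: "i < r" by simp
      have "0 \<le> (w i \<bullet> w i) * (a $ i * a $ i)"
        by (rule mult_nonneg_nonneg[OF less_imp_le[OF pos[OF i]] zero_le_square])
      then show "c * ((w i \<bullet> w i) * (a $ i * a $ i)) \<le> \<mu> i * ((w i \<bullet> w i) * (a $ i * a $ i))"
        by (rule mult_right_mono[OF \<mu>[OF i]])
    qed
    then show "(c - \<delta>) * (?x \<bullet> ?x) \<le> ?x \<bullet> (A *\<^sub>v ?x)"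
      using dominates[of ?x] W a by (simp add: left_diff_distrib)
  qed
qed

section \<open>Order statistics of a spectrum\<close>

lemma nth_largest_ge:
  assumes "1 \<le> i" "i \<le> size (filter_mset (\<lambda>x. c \<le> x) M)"
  shows "c \<le> nth_largest i M"
proof -
  define xs where "xs = sorted_list_of_multiset M"
  have M: "mset xs = M" and sorted: "sorted xs" by (auto simp: xs_def)
  have len: "i \<le> length xs"
    using assms(2) size_filter_mset_lesseq[of "\<lambda>x. c \<le> x" M] by (metis M le_trans size_mset)
  show ?thesis
  proof (rule ccontr)
    assume "\<not> ?thesis"
    then have less: "xs ! (length xs - i) < c"
      using assms(1) len by (simp add: nth_largest_def xs_def[symmetric] rev_nth)
    have "{p. p < length xs \<and> c \<le> xs ! p} \<subseteq> {length xs - i<..<length xs}"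
    proof
      fix p assume p: "p \<in> {p. p < length xs \<and> c \<le> xs ! p}"
      have "length xs - i < length xs" using p assms(1) by auto
      then have "\<not> p \<le> length xs - i"
        using p less sorted_nth_mono[OF sorted, of p "length xs - i"] assms(1) len by auto
      then show "p \<in> {length xs - i<..<length xs}" using p by auto
    qed
    then have "card {p. p < length xs \<and> c \<le> xs ! p} \<le> card {length xs - i<..<length xs}"
      by (rule card_mono[rotated]) simp
    also have "\<dots> < i" using assms(1) len by simp
    also have "card {p. p < length xs \<and> c \<le> xs ! p} = size (filter_mset (\<lambda>x. c \<le> x) M)"
      unfolding M[symmetric] mset_filter[symmetric] size_mset by (rule length_filter_conv_card[symmetric])
    finally show False using assms(2) by simp
  qed
qed

text \<open>
  The \<open>i\<close>-th largest element is the \<open>(size M - i + 1)\<close>-th smallest one.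
\<close>

lemma nth_largest_le:
  assumes "1 \<le> i" "i \<le> size M" "size M - i < size (filter_mset (\<lambda>x. x \<le> c) M)"
  shows "nth_largest i M \<le> c"
proof -
  define xs where "xs = sorted_list_of_multiset M"
  have M: "mset xs = M" and sorted: "sorted xs" by (auto simp: xs_def)
  have len: "size M = length xs" using M by auto
  show ?thesis
  proof (rule ccontr)
    assume "\<not> ?thesis"
    then have less: "c < xs ! (length xs - i)"
      using assms(1,2) len by (simp add: nth_largest_def xs_def[symmetric] rev_nth)
    have "{p. p < length xs \<and> xs ! p \<le> c} \<subseteq> {..<length xs - i}"
    proof
      fix p assume p: "p \<in> {p. p < length xs \<and> xs ! p \<le> c}"
      have "\<not> length xs - i \<le> p"
        using p less sorted_nth_mono[OF sorted, of "length xs - i" p] by auto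
      then show "p \<in> {..<length xs - i}" by auto
    qed
    then have "card {p. p < length xs \<and> xs ! p \<le> c} \<le> card {..<length xs - i}"
      by (rule card_mono[rotated]) simp
    also have "card {p. p < length xs \<and> xs ! p \<le> c} = size (filter_mset (\<lambda>x. x \<le> c) M)"
      unfolding M[symmetric] mset_filter[symmetric] size_mset by (rule length_filter_conv_card[symmetric])
    finally show False using assms(3) len by simp
  qed
qed

lemma card_ge_if_nth_largest_ge:
  assumes "1 \<le> i" "i \<le> size M" "c \<le> nth_largest i M"
  shows "i \<le> size (filter_mset (\<lambda>x. c \<le> x) M)"
proof -
  define xs where "xs = sorted_list_of_multiset M"
  have M: "mset xs = M" and sorted: "sorted xs" by (auto simp: xs_def)
  have len: "size M = length xs" using M by auto
  have ge: "c \<le> xs ! (length xs - i)"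
    using assms len by (simp add: nth_largest_def xs_def[symmetric] rev_nth)
  have "{length xs - i..<length xs} \<subseteq> {p. p < length xs \<and> c \<le> xs ! p}"
    using ge sorted_nth_mono[OF sorted, of "length xs - i"] by force
  then have "card {length xs - i..<length xs} \<le> card {p. p < length xs \<and> c \<le> xs ! p}"
    by (rule card_mono[rotated]) simp
  also have "card {p. p < length xs \<and> c \<le> xs ! p} = size (filter_mset (\<lambda>x. c \<le> x) M)"
    unfolding M[symmetric] mset_filter[symmetric] size_mset by (rule length_filter_conv_card[symmetric])
  finally show ?thesis using assms(1,2) len by simp
qed

lemma size_filter_spectrum:
  fixes n :: nat
  shows "size (filter_mset P (image_mset d (mset_set {..<n}))) = card {i. i < n \<and> P (d i)}"
proof -
  have "size (filter_mset P (image_mset d (mset_set {..<n}))) = card {i \<in> {..<n}. P (d i)}"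
    by (simp add: filter_mset_image_mset)
  also have "{i \<in> {..<n}. P (d i)} = {i. i < n \<and> P (d i)}" by auto
  finally show ?thesis .
qed

section \<open>The graph of a sign matrix\<close>

definition all_ones :: "nat \<Rightarrow> real vec" where
  "all_ones n = vec n (\<lambda>_. 1)"

text \<open>
  For a symmetric sign matrix \<open>B\<close> the non-edges are the off-diagonal entries -1, so that the Seidel
  matrix of the graph is \<open>- B\<close> with its diagonal replaced by zeros.
\<close>

definition sign_graph :: "nat \<Rightarrow> real mat \<Rightarrow> nat pair_pre_digraph" where
  "sign_graph n B =
     \<lparr> pverts = {..<n}, parcs = {(i, j). i < n \<and> j < n \<and> i \<noteq> j \<and> B $$ (i, j) = 1} \<rparr>"

lemma pair_graph_sign_graph:
  assumes B: "B \<in> carrier_mat n n" and sym: "B\<^sup>T = B"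
  shows "pair_graph (sign_graph n B)"
proof -
  have fin: "finite (parcs (sign_graph n B))"
    by (rule finite_subset[of _ "{..<n} \<times> {..<n}"]) (auto simp: sign_graph_def)
  have "B $$ (j, i) = B $$ (i, j)" if "i < n" "j < n" for i j
    using that B arg_cong[OF sym, of "\<lambda>M. M $$ (i, j)"] by simp
  then show ?thesis
    using fin
    by unfold_locales
      (auto simp: sign_graph_def symmetric_def arcs_ends_def arc_to_ends_def intro!: symI)
qed

lemma complement_sign_graph:
  assumes B: "B \<in> carrier_mat n n"
    and sign: "\<And>i j. i < n \<Longrightarrow> j < n \<Longrightarrow> B $$ (i, j) \<in> {-1, 1}"
  shows "complement_graph (sign_graph n B) = sign_graph n (- B)"
proof -
  have "B $$ (i, j) \<noteq> 1 \<longleftrightarrow> (- B) $$ (i, j) = 1" if "i < n" "j < n" for i j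
    using sign[OF that] that B by auto
  then show ?thesis by (auto simp: complement_graph_def sign_graph_def)
qed

lemma adjacency_matrix_sign_graph:
  "adjacency_matrix (sign_graph n B) =
     mat n n (\<lambda>(i, j). if i \<noteq> j \<and> B $$ (i, j) = 1 then 1 else 0)"
proof -
  have "sorted_list_of_set {..<n} = [0..<n]"
    by (simp add: lessThan_atLeast0)
  then show ?thesis
    by (auto simp: adjacency_matrix_def sign_graph_def graph_order_def Let_def intro!: eq_matI)
qed

lemma quadratic_form_sum:
  fixes M :: "real mat"
  assumes "M \<in> carrier_mat n n" "x \<in> carrier_vec n"
  shows "x \<bullet> (M *\<^sub>v x) = (\<Sum>i<n. \<Sum>j<n. x $ i * M $$ (i, j) * x $ j)"
proof -
  have "x \<bullet> (M *\<^sub>v x) = (\<Sum>i<n. x $ i * (\<Sum>j<n. M $$ (i, j) * x $ j))"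
    using assms by (auto simp: scalar_prod_def atLeast0LessThan intro!: sum.cong)
  then show ?thesis by (simp add: sum_distrib_left mult.assoc)
qed

text \<open>
  Here \<open>E = (J + B) / 2\<close>, with \<open>J\<close> the all-ones matrix, is the adjacency matrix together with a loop
  at each vertex whose diagonal entry in \<open>B\<close> is 1. Deleting the loops subtracts a diagonal matrix
  with entries 0 and 1. This one-sided error is why an upper estimate for the small eigenvalues
  loses nothing, while a lower estimate for the large ones loses 1.
\<close>

lemma sign_graph_quadratic_form:
  assumes B: "B \<in> carrier_mat n n"
    and sign: "\<And>i j. i < n \<Longrightarrow> j < n \<Longrightarrow> B $$ (i, j) \<in> {-1, 1}"
    and x: "x \<in> carrier_vec n"
  defines "E \<equiv> mat n n (\<lambda>(i, j). (1 + B $$ (i, j)) / 2)"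
    and "A \<equiv> adjacency_matrix (sign_graph n B)"
  shows "x \<bullet> (E *\<^sub>v x) - 1 * (x \<bullet> x) \<le> x \<bullet> (A *\<^sub>v x)"
    and "x \<bullet> (A *\<^sub>v x) \<le> x \<bullet> (E *\<^sub>v x)"
proof -
  let ?l = "\<Sum>i<n. (1 + B $$ (i, i)) / 2 * (x $ i * x $ i)"
  have A: "A \<in> carrier_mat n n" by (simp add: A_def adjacency_matrix_sign_graph)
  have E: "E \<in> carrier_mat n n" by (simp add: E_def)
  have entry: "x $ i * E $$ (i, j) * x $ j - x $ i * A $$ (i, j) * x $ j =
    (if j = i then (1 + B $$ (i, i)) / 2 * (x $ i * x $ i) else 0)" if "i < n" "j < n" for i j
    using sign[OF that] that by (auto simp: E_def A_def adjacency_matrix_sign_graph)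
  have "x \<bullet> (E *\<^sub>v x) - x \<bullet> (A *\<^sub>v x) =
    (\<Sum>i<n. \<Sum>j<n. if j = i then (1 + B $$ (i, i)) / 2 * (x $ i * x $ i) else 0)"
    unfolding quadratic_form_sum[OF E x] quadratic_form_sum[OF A x] sum_subtractf[symmetric]
    by (intro sum.cong refl entry) auto
  also have "\<dots> = ?l" by simp
  finally have diff: "x \<bullet> (E *\<^sub>v x) - x \<bullet> (A *\<^sub>v x) = ?l" .
  have "?l \<le> (\<Sum>i<n. x $ i * x $ i)"
  proof (rule sum_mono)
    fix i assume "i \<in> {..<n}"
    then show "(1 + B $$ (i, i)) / 2 * (x $ i * x $ i) \<le> x $ i * x $ i"
      using sign[of i i] by auto
  qed
  also have "\<dots> = x \<bullet> x" using x by (simp add: scalar_prod_def atLeast0LessThan)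
  finally show "x \<bullet> (E *\<^sub>v x) - 1 * (x \<bullet> x) \<le> x \<bullet> (A *\<^sub>v x)" using diff by simp
  have "0 \<le> ?l"
  proof (rule sum_nonneg)
    fix i assume "i \<in> {..<n}"
    then show "0 \<le> (1 + B $$ (i, i)) / 2 * (x $ i * x $ i)"
      using sign[of i i] by auto
  qed
  then show "x \<bullet> (A *\<^sub>v x) \<le> x \<bullet> (E *\<^sub>v x)" using diff by simp
qed

lemma eigenvector_orthogonal_to_kernel:
  fixes M :: "real mat"
  assumes M: "M \<in> carrier_mat n n" "M\<^sup>T = M"
    and u: "u \<in> carrier_vec n" "M *\<^sub>v u = \<mu> \<cdot>\<^sub>v u" "\<mu> \<noteq> 0"
    and z: "z \<in> carrier_vec n" "M *\<^sub>v z = 0\<^sub>v n"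
  shows "z \<bullet> u = 0"
proof -
  have "\<mu> * (z \<bullet> u) = z \<bullet> (M *\<^sub>v u)" using u z by simp
  also have "\<dots> = (M\<^sup>T *\<^sub>v z) \<bullet> u"
    by (rule transpose_vec_mult_scalar[OF M(1) u(1) z(1), symmetric])
  also have "\<dots> = 0" using M(2) z(2) u(1) by simp
  finally show ?thesis using u(3) by simp
qed

text \<open>
  Since the all-ones vector lies in the kernel of \<open>B\<close>, the eigenvectors of \<open>B\<close> for nonzero
  eigenvalues are orthogonal to it. Hence \<open>J + B\<close> has all of them as eigenvectors with unchanged
  eigenvalues, and the all-ones vector as a further one with eigenvalue \<open>n\<close>. This is the additional
  large eigenvalue that turns the index \<open>k\<close> into \<open>k + 1\<close>, and it costs nothing at the lower end of
  the spectrum.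
\<close>

lemma sign_graph_eigenvalue_bounds:
  assumes B: "B \<in> carrier_mat n n" "B\<^sup>T = B"
    and sign: "\<And>i j. i < n \<Longrightarrow> j < n \<Longrightarrow> B $$ (i, j) \<in> {-1, 1}"
    and ones: "B *\<^sub>v all_ones n = 0\<^sub>v n"
    and k: "1 \<le> k" and c: "0 < c" "c \<le> real n"
    and pos: "orthogonal_eigenvectors n B k u \<mu>" "\<And>i. i < k \<Longrightarrow> c \<le> \<mu> i"
    and neg: "orthogonal_eigenvectors n B k u' \<nu>" "\<And>i. i < k \<Longrightarrow> \<nu> i \<le> - c"
  shows "c / 2 - 1 \<le> graph_eigenvalue (k + 1) (sign_graph n B)"
    and "graph_eigenvalue (n - k + 1) (sign_graph n B) \<le> - (c / 2)"
proof -
  let ?A = "adjacency_matrix (sign_graph n B)"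
  define E where "E = mat n n (\<lambda>(i, j). (1 + B $$ (i, j)) / 2)"
  have E: "E \<in> carrier_mat n n" by (simp add: E_def)
  have A: "?A \<in> carrier_mat n n" by (simp add: adjacency_matrix_sign_graph)
  have Bij: "B $$ (j, i) = B $$ (i, j)" if "i < n" "j < n" for i j
    using that B(1) arg_cong[OF B(2), of "\<lambda>M. M $$ (i, j)"] by simp
  have A_sym: "?A\<^sup>T = ?A"
    by (rule eq_matI) (auto simp: adjacency_matrix_sign_graph Bij)
  obtain U d where spec: "spectral_decomposition n ?A U d"
    using real_spectral_theorem[OF A A_sym] by blast
  note mset_A = eigenvalue_mset_spectral_decomposition[OF spec]
  have all_ones: "all_ones n \<in> carrier_vec n" by (simp add: all_ones_def)
  have E_mult: "E *\<^sub>v x = ((all_ones n \<bullet> x) / 2) \<cdot>\<^sub>v all_ones n + (1 / 2) \<cdot>\<^sub>v (B *\<^sub>v x)"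
    if x: "x \<in> carrier_vec n" for x
    by (rule eq_vecI)
      (use x B(1) in \<open>auto simp: E_def all_ones_def scalar_prod_def sum_divide_distrib
         sum.distrib[symmetric] field_simps\<close>)
  have E_eigen: "all_ones n \<bullet> x = 0" "E *\<^sub>v x = (\<rho> / 2) \<cdot>\<^sub>v x"
    if x: "x \<in> carrier_vec n" "B *\<^sub>v x = \<rho> \<cdot>\<^sub>v x" "\<rho> \<noteq> 0" for x \<rho>
  proof -
    show orth: "all_ones n \<bullet> x = 0"
      by (rule eigenvector_orthogonal_to_kernel[OF B x all_ones ones])
    show "E *\<^sub>v x = (\<rho> / 2) \<cdot>\<^sub>v x"
      unfolding E_mult[OF x(1)] orth x(2)
      by (rule eq_vecI) (use x(1) all_ones in auto)
  qed
  have u: "u i \<in> carrier_vec n" "u i \<noteq> 0\<^sub>v n" "B *\<^sub>v u i = \<mu> i \<cdot>\<^sub>v u i" "\<mu> i \<noteq> 0" if "i < k" for i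
    using pos that c(1) by (auto simp: orthogonal_eigenvectors_def dest!: pos(2))
  have u': "u' i \<in> carrier_vec n" "u' i \<noteq> 0\<^sub>v n" "B *\<^sub>v u' i = \<nu> i \<cdot>\<^sub>v u' i" "\<nu> i \<noteq> 0" if "i < k" for i
    using neg that c(1) by (auto simp: orthogonal_eigenvectors_def dest!: neg(2))
  have n: "n > 0" using c by simp
  show "c / 2 - 1 \<le> graph_eigenvalue (k + 1) (sign_graph n B)"
  proof -
    \<comment> \<open>The all-ones vector comes first, followed by the \<open>k\<close> eigenvectors of \<open>B\<close>.\<close>
    define w where "w i = (case i of 0 \<Rightarrow> all_ones n | Suc j \<Rightarrow> u j)" for i
    define \<kappa> where "\<kappa> i = (case i of 0 \<Rightarrow> real n / 2 | Suc j \<Rightarrow> \<mu> j / 2)" for i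
    have "orthogonal_eigenvectors n E (k + 1) w \<kappa>"
      unfolding orthogonal_eigenvectors_def
    proof (intro conjI allI impI)
      fix i assume i: "i < k + 1"
      show "w i \<in> carrier_vec n" using i u(1) all_ones by (auto simp: w_def split: nat.split)
      show "w i \<noteq> 0\<^sub>v n"
      proof (cases i)
        case 0
        have "all_ones n $ 0 \<noteq> 0\<^sub>v n $ 0" using n by (simp add: all_ones_def)
        then show ?thesis using 0 by (auto simp: w_def)
      qed (use i u(2) in \<open>auto simp: w_def\<close>)
      show "E *\<^sub>v w i = \<kappa> i \<cdot>\<^sub>v w i"
      proof (cases i)
        case 0
        have "all_ones n \<bullet> all_ones n = real n" by (simp add: all_ones_def scalar_prod_def)
        then have "E *\<^sub>v all_ones n = (real n / 2) \<cdot>\<^sub>v all_ones n"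
          unfolding E_mult[OF all_ones] ones by (intro eq_vecI) (use all_ones in auto)
        then show ?thesis using 0 by (simp add: w_def \<kappa>_def)
      next
        case (Suc j)
        then show ?thesis using E_eigen(2)[OF u(1,3,4)] i by (simp add: w_def \<kappa>_def)
      qed
    next
      fix i j assume ij: "i < k + 1" "j < k + 1" "i \<noteq> j"
      have ones_u: "all_ones n \<bullet> u p = 0" if "p < k" for p
        using E_eigen(1) u[OF that] by blast
      moreover have "u p \<bullet> all_ones n = 0" if "p < k" for p
        using ones_u[OF that] comm_scalar_prod[OF u(1)[OF that] all_ones] by simp
      moreover have "u p \<bullet> u q = 0" if "p < k" "q < k" "p \<noteq> q" for p q
        using pos(1) that by (auto simp: orthogonal_eigenvectors_def)
      ultimately show "w i \<bullet> w j = 0"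
        using ij by (cases i; cases j) (auto simp: w_def)
    qed
    moreover have "c / 2 \<le> \<kappa> i" if "i < k + 1" for i
      using that c(2) pos(2) by (auto simp: \<kappa>_def split: nat.split)
    ultimately have "k + 1 \<le> card {i. i < n \<and> c / 2 - 1 \<le> d i}"
      using eigenvalue_count_lower_bound[OF spec E, of "k + 1" w \<kappa> "c / 2" 1]
        sign_graph_quadratic_form(1)[OF B(1) sign, folded E_def] by blast
    then show ?thesis
      unfolding graph_eigenvalue_def mset_A
      by (intro nth_largest_ge) (simp_all add: size_filter_spectrum)
  qed
  show "graph_eigenvalue (n - k + 1) (sign_graph n B) \<le> - (c / 2)"
  proof -
    \<comment> \<open>Small eigenvalues are large eigenvalues of the negated matrices.\<close>
    have mE: "- E \<in> carrier_mat n n" using E by simp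
    have "orthogonal_eigenvectors n (- E) k u' (\<lambda>i. - (\<nu> i / 2))"
      unfolding orthogonal_eigenvectors_def
    proof (intro conjI allI impI)
      fix i assume i: "i < k"
      show "u' i \<in> carrier_vec n" "u' i \<noteq> 0\<^sub>v n" using u'[OF i] by auto
      show "- E *\<^sub>v u' i = - (\<nu> i / 2) \<cdot>\<^sub>v u' i"
        using E_eigen(2)[OF u'(1)[OF i] u'(3)[OF i] u'(4)[OF i]] u'(1)[OF i] E
        by (intro eq_vecI) auto
    next
      fix i j assume "i < k" "j < k" "i \<noteq> j"
      then show "u' i \<bullet> u' j = 0" using neg(1) by (auto simp: orthogonal_eigenvectors_def)
    qed
    moreover have "c / 2 \<le> - (\<nu> i / 2)" if "i < k" for i using neg(2)[OF that] by simp
    moreover have "x \<bullet> (- E *\<^sub>v x) - 0 * (x \<bullet> x) \<le> x \<bullet> (- ?A *\<^sub>v x)" if x: "x \<in> carrier_vec n" for x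
      using sign_graph_quadratic_form(2)[OF B(1) sign x, folded E_def] x E A by simp
    ultimately have "k \<le> card {i. i < n \<and> c / 2 - 0 \<le> - d i}"
      using eigenvalue_count_lower_bound[OF spectral_decomposition_uminus[OF spec] mE,
          of k u' "\<lambda>i. - (\<nu> i / 2)" "c / 2" 0] by blast
    also have "{i. i < n \<and> c / 2 - 0 \<le> - d i} = {i. i < n \<and> d i \<le> - (c / 2)}" by auto
    finally have count: "k \<le> card {i. i < n \<and> d i \<le> - (c / 2)}" .
    also have "\<dots> \<le> card {..<n}" by (rule card_mono) auto
    finally have "k \<le> n" by simp
    then show ?thesis
      unfolding graph_eigenvalue_def mset_A
      using k count by (intro nth_largest_le) (simp_all add: size_filter_spectrum)
  qed
qed

section \<open>Kronecker products\<close>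

text \<open>
  The first factor runs fastest: an index \<open>i\<close> stands for the pair of \<open>i mod m\<close> in the first factor
  of order \<open>m\<close> and \<open>i div m\<close> in the second one.
\<close>

definition kronecker_mat :: "'a :: semiring_0 mat \<Rightarrow> 'a mat \<Rightarrow> 'a mat" where
  "kronecker_mat A B =
     mat (dim_row A * dim_row B) (dim_col A * dim_col B)
       (\<lambda>(i, j). A $$ (i mod dim_row A, j mod dim_col A) * B $$ (i div dim_row A, j div dim_col A))"

definition kronecker_vec :: "'a :: semiring_0 vec \<Rightarrow> 'a vec \<Rightarrow> 'a vec" where
  "kronecker_vec v w =
     vec (dim_vec v * dim_vec w) (\<lambda>i. v $ (i mod dim_vec v) * w $ (i div dim_vec v))"

lemma kronecker_mat_carrier:
  "A \<in> carrier_mat m m' \<Longrightarrow> B \<in> carrier_mat p p' \<Longrightarrow>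
    kronecker_mat A B \<in> carrier_mat (m * p) (m' * p')"
  by (simp add: kronecker_mat_def)

lemma kronecker_vec_carrier:
  "v \<in> carrier_vec m \<Longrightarrow> w \<in> carrier_vec p \<Longrightarrow> kronecker_vec v w \<in> carrier_vec (m * p)"
  by (simp add: kronecker_vec_def)

lemma div_mod_less_product:
  fixes i m p :: nat
  assumes "i < m * p"
  shows "i mod m < m" "i div m < p"
proof -
  have "m > 0" using assms by (cases m) auto
  then show "i mod m < m" "i div m < p"
    using assms by (auto simp: less_mult_imp_div_less mult.commute)
qed

lemma kronecker_mat_transpose:
  "(kronecker_mat A B)\<^sup>T = kronecker_mat (A\<^sup>T) (B\<^sup>T)"
  by (rule eq_matI) (auto simp: kronecker_mat_def div_mod_less_product)

lemma kronecker_mat_sign: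
  fixes A B :: "real mat"
  assumes A: "A \<in> carrier_mat m m'" "\<And>i j. i < m \<Longrightarrow> j < m' \<Longrightarrow> A $$ (i, j) \<in> {-1, 1}"
    and B: "B \<in> carrier_mat p p'" "\<And>i j. i < p \<Longrightarrow> j < p' \<Longrightarrow> B $$ (i, j) \<in> {-1, 1}"
    and ij: "i < m * p" "j < m' * p'"
  shows "kronecker_mat A B $$ (i, j) \<in> {-1, 1}"
  using A(2)[of "i mod m" "j mod m'"] B(2)[of "i div m" "j div m'"] A(1) B(1) ij
  by (auto simp: kronecker_mat_def div_mod_less_product)

lemma sum_mod_div_product:
  fixes f g :: "nat \<Rightarrow> 'a :: comm_semiring_0"
  shows "(\<Sum>i<m * p. f (i mod m) * g (i div m)) = (\<Sum>i<m. f i) * (\<Sum>j<p. g j)"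
proof -
  have "(\<Sum>i<m * p. f (i mod m) * g (i div m)) =
    (\<Sum>j<p. \<Sum>i\<in>{j * m..<j * m + m}. f (i mod m) * g (i div m))"
    by (subst sum.nat_group) (simp add: mult.commute)
  also have "\<dots> = (\<Sum>j<p. \<Sum>i<m. f i * g j)"
  proof (rule sum.cong[OF refl])
    fix j
    have "(\<Sum>i\<in>{j * m..<j * m + m}. f (i mod m) * g (i div m)) =
      (\<Sum>i\<in>{0..<m}. f ((i + j * m) mod m) * g ((i + j * m) div m))"
      using sum.shift_bounds_nat_ivl[of "\<lambda>i. f (i mod m) * g (i div m)" 0 "j * m" m]
      by (simp add: add.commute)
    then show "(\<Sum>i\<in>{j * m..<j * m + m}. f (i mod m) * g (i div m)) = (\<Sum>i<m. f i * g j)"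
      by (simp add: atLeast0LessThan)
  qed
  also have "\<dots> = (\<Sum>i<m. f i) * (\<Sum>j<p. g j)"
    by (simp add: sum_distrib_left sum_distrib_right)
  finally show ?thesis .
qed

lemma kronecker_scalar_prod:
  fixes v v' w w' :: "'a :: comm_semiring_0 vec"
  assumes "v \<in> carrier_vec m" "v' \<in> carrier_vec m" "w \<in> carrier_vec p" "w' \<in> carrier_vec p"
  shows "kronecker_vec v w \<bullet> kronecker_vec v' w' = (v \<bullet> v') * (w \<bullet> w')"
proof -
  have "kronecker_vec v w \<bullet> kronecker_vec v' w' =
    (\<Sum>i<m * p. (v $ (i mod m) * v' $ (i mod m)) * (w $ (i div m) * w' $ (i div m)))"
    using assms by (auto simp: kronecker_vec_def scalar_prod_def atLeast0LessThan mult_ac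
      intro!: sum.cong)
  also have "\<dots> = (v \<bullet> v') * (w \<bullet> w')"
    using assms by (subst sum_mod_div_product) (simp add: scalar_prod_def atLeast0LessThan)
  finally show ?thesis .
qed

lemma kronecker_mat_mult_vec:
  fixes A B :: "'a :: comm_semiring_0 mat"
  assumes A: "A \<in> carrier_mat m m'" and B: "B \<in> carrier_mat p p'"
    and v: "v \<in> carrier_vec m'" and w: "w \<in> carrier_vec p'"
  shows "kronecker_mat A B *\<^sub>v kronecker_vec v w = kronecker_vec (A *\<^sub>v v) (B *\<^sub>v w)"
proof (rule eq_vecI)
  fix i assume "i < dim_vec (kronecker_vec (A *\<^sub>v v) (B *\<^sub>v w))"
  then have i: "i < m * p" using A B by (simp add: kronecker_vec_def)
  note i' = div_mod_less_product[OF i]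
  have "row (kronecker_mat A B) i = kronecker_vec (row A (i mod m)) (row B (i div m))"
    by (rule eq_vecI)
      (use A B i i' in \<open>auto simp: kronecker_mat_def kronecker_vec_def div_mod_less_product\<close>)
  then have "(kronecker_mat A B *\<^sub>v kronecker_vec v w) $ i =
    (row A (i mod m) \<bullet> v) * (row B (i div m) \<bullet> w)"
    using kronecker_scalar_prod[OF row_carrier_vec[OF i'(1) A] v row_carrier_vec[OF i'(2) B] w] A B i
    by (simp add: kronecker_mat_def)
  then show "(kronecker_mat A B *\<^sub>v kronecker_vec v w) $ i =
    kronecker_vec (A *\<^sub>v v) (B *\<^sub>v w) $ i"
    using A B i i' by (simp add: kronecker_vec_def)
qed (use A B in \<open>simp add: kronecker_mat_def kronecker_vec_def\<close>)

lemma kronecker_all_ones: "all_ones (m * p) = kronecker_vec (all_ones m) (all_ones p)"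
  by (rule eq_vecI) (auto simp: all_ones_def kronecker_vec_def div_mod_less_product)

lemma kronecker_eigenvector:
  fixes A B :: "real mat"
  assumes A: "A \<in> carrier_mat m m" and B: "B \<in> carrier_mat p p"
    and v: "v \<in> carrier_vec m" "A *\<^sub>v v = \<alpha> \<cdot>\<^sub>v v"
    and w: "w \<in> carrier_vec p" "B *\<^sub>v w = \<beta> \<cdot>\<^sub>v w"
  shows "kronecker_mat A B *\<^sub>v kronecker_vec v w = (\<alpha> * \<beta>) \<cdot>\<^sub>v kronecker_vec v w"
  unfolding kronecker_mat_mult_vec[OF A B v(1) w(1)] v(2) w(2)
  by (rule eq_vecI) (use v(1) w(1) in \<open>auto simp: kronecker_vec_def div_mod_less_product\<close>)

text \<open>
  The second factor may change with the index, because orthogonality of the first factors alone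
  makes the products orthogonal.
\<close>

lemma kronecker_orthogonal_eigenvectors:
  assumes A: "A \<in> carrier_mat m m" and B: "B \<in> carrier_mat p p"
    and ev: "orthogonal_eigenvectors m A r v \<mu>"
    and w: "\<And>i. i < r \<Longrightarrow> w i \<in> carrier_vec p" "\<And>i. i < r \<Longrightarrow> w i \<noteq> 0\<^sub>v p"
      "\<And>i. i < r \<Longrightarrow> B *\<^sub>v w i = \<beta> i \<cdot>\<^sub>v w i"
  shows "orthogonal_eigenvectors (m * p) (kronecker_mat A B) r
    (\<lambda>i. kronecker_vec (v i) (w i)) (\<lambda>i. \<mu> i * \<beta> i)"
  unfolding orthogonal_eigenvectors_def
proof (intro conjI allI impI)
  have v: "v i \<in> carrier_vec m" "v i \<noteq> 0\<^sub>v m" "A *\<^sub>v v i = \<mu> i \<cdot>\<^sub>v v i" if "i < r" for i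
    using ev that by (auto simp: orthogonal_eigenvectors_def)
  fix i assume i: "i < r"
  show carrier: "kronecker_vec (v i) (w i) \<in> carrier_vec (m * p)"
    by (rule kronecker_vec_carrier[OF v(1)[OF i] w(1)[OF i]])
  have "kronecker_vec (v i) (w i) \<bullet> kronecker_vec (v i) (w i) > 0"
    unfolding kronecker_scalar_prod[OF v(1)[OF i] v(1)[OF i] w(1)[OF i] w(1)[OF i]]
    using real_scalar_prod_self_pos v(1,2)[OF i] w(1,2)[OF i] by (intro mult_pos_pos) blast+
  then show "kronecker_vec (v i) (w i) \<noteq> 0\<^sub>v (m * p)" by auto
  show "kronecker_mat A B *\<^sub>v kronecker_vec (v i) (w i) =
    (\<mu> i * \<beta> i) \<cdot>\<^sub>v kronecker_vec (v i) (w i)"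
    by (rule kronecker_eigenvector[OF A B v(1)[OF i] v(3)[OF i] w(1)[OF i] w(3)[OF i]])
next
  fix i j assume ij: "i < r" "j < r" "i \<noteq> j"
  then have "v i \<in> carrier_vec m" "v j \<in> carrier_vec m" "v i \<bullet> v j = 0"
    using ev by (auto simp: orthogonal_eigenvectors_def)
  then show "kronecker_vec (v i) (w i) \<bullet> kronecker_vec (v j) (w j) = 0"
    using kronecker_scalar_prod[of "v i" m "v j" "w i" p "w j"] w(1) ij by simp
qed

section \<open>The Hadamard and checkerboard factors\<close>

definition hadamard_2 :: "real mat" where
  "hadamard_2 = mat 2 2 (\<lambda>(i, j). if i = 1 \<and> j = 1 then - 1 else 1)"

text \<open>
  For \<open>s = 1\<close> and \<open>s = -1\<close> these are the eigenvectors of the Hadamard matrix of order 2 for its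
  eigenvalues \<open>s \<surd>2\<close>.
\<close>

definition hadamard_2_eigenvector :: "real \<Rightarrow> real vec" where
  "hadamard_2_eigenvector s = vec 2 (\<lambda>i. if i = 0 then 1 else s * sqrt 2 - 1)"

lemma hadamard_2_eigen:
  assumes "s * s = 1"
  shows "hadamard_2 *\<^sub>v hadamard_2_eigenvector s = (s * sqrt 2) \<cdot>\<^sub>v hadamard_2_eigenvector s"
proof (rule eq_vecI)
  have ss: "s * sqrt 2 * (s * sqrt 2) = 2"
  proof -
    have "s * sqrt 2 * (s * sqrt 2) = (s * s) * (sqrt 2 * sqrt 2)" by (simp only: mult_ac)
    then show ?thesis using assms by simp
  qed
  fix i assume "i < dim_vec ((s * sqrt 2) \<cdot>\<^sub>v hadamard_2_eigenvector s)"
  then have "i = 0 \<or> i = 1" by (auto simp: hadamard_2_eigenvector_def)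
  then show "(hadamard_2 *\<^sub>v hadamard_2_eigenvector s) $ i =
    ((s * sqrt 2) \<cdot>\<^sub>v hadamard_2_eigenvector s) $ i"
    using ss by (auto simp: hadamard_2_def hadamard_2_eigenvector_def scalar_prod_def
      right_diff_distrib numeral_2_eq_2)
qed (simp add: hadamard_2_def hadamard_2_eigenvector_def)

definition alternating_vec :: "nat \<Rightarrow> real vec" where
  "alternating_vec p = vec p (\<lambda>i. (- 1) ^ i)"

text \<open>
  The matrix \<open>a a\<^sup>T\<close> of rank one for the alternating vector \<open>a\<close>. For even order \<open>a\<close> is orthogonal to
  the all-ones vector.
\<close>

definition checkerboard :: "nat \<Rightarrow> real mat" where
  "checkerboard p = mat p p (\<lambda>(i, j). (- 1) ^ (i + j))"

lemma checkerboard_mult_vec: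
  assumes "x \<in> carrier_vec p"
  shows "checkerboard p *\<^sub>v x = (alternating_vec p \<bullet> x) \<cdot>\<^sub>v alternating_vec p"
  by (rule eq_vecI)
    (use assms in \<open>auto simp: checkerboard_def alternating_vec_def scalar_prod_def power_add
       sum_distrib_left sum_distrib_right mult_ac intro!: sum.cong\<close>)

lemma checkerboard_eigen:
  "checkerboard p *\<^sub>v alternating_vec p = real p \<cdot>\<^sub>v alternating_vec p"
proof -
  have "alternating_vec p \<bullet> alternating_vec p = real p"
    by (simp add: alternating_vec_def scalar_prod_def power_add[symmetric] flip: power_mult_distrib)
  then show ?thesis
    by (subst checkerboard_mult_vec) (simp_all add: alternating_vec_def)
qed

lemma checkerboard_all_ones: "checkerboard (2 * t) *\<^sub>v all_ones (2 * t) = 0\<^sub>v (2 * t)"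
proof -
  have "(\<Sum>i<2 * t. (- 1) ^ i :: real) = 0" by (induction t) auto
  then have "alternating_vec (2 * t) \<bullet> all_ones (2 * t) = 0"
    by (simp add: alternating_vec_def all_ones_def scalar_prod_def atLeast0LessThan)
  then show ?thesis
    by (subst checkerboard_mult_vec) (auto simp: all_ones_def alternating_vec_def)
qed

text \<open>
  The free choice of the signs \<open>s\<close> is the purpose of the Hadamard factor: whatever the signs of the nonzero
  eigenvalues \<open>\<mu>\<close> are, \<open>s i = sgn (\<mu> i)\<close> makes all the new eigenvalues positive and the opposite
  choice makes them negative.
\<close>

lemma blow_up_eigenvectors:
  assumes A: "A \<in> carrier_mat m m" and ev: "orthogonal_eigenvectors m A k v \<mu>"
    and s: "\<And>i. i < k \<Longrightarrow> s i * s i = 1" and t: "t > 0"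
  shows "orthogonal_eigenvectors (m * (2 * (2 * t)))
    (kronecker_mat A (kronecker_mat hadamard_2 (checkerboard (2 * t)))) k
    (\<lambda>i. kronecker_vec (v i) (kronecker_vec (hadamard_2_eigenvector (s i)) (alternating_vec (2 * t))))
    (\<lambda>i. \<mu> i * (s i * sqrt 2 * real (2 * t)))"
proof (rule kronecker_orthogonal_eigenvectors[OF A _ ev])
  let ?K = "checkerboard (2 * t)" and ?a = "alternating_vec (2 * t)"
  have H: "hadamard_2 \<in> carrier_mat 2 2" by (simp add: hadamard_2_def)
  have K: "?K \<in> carrier_mat (2 * t) (2 * t)" by (simp add: checkerboard_def)
  show "kronecker_mat hadamard_2 ?K \<in> carrier_mat (2 * (2 * t)) (2 * (2 * t))"
    by (rule kronecker_mat_carrier[OF H K])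
  fix i assume i: "i < k"
  let ?h = "hadamard_2_eigenvector (s i)"
  have h: "?h \<in> carrier_vec 2" by (simp add: hadamard_2_eigenvector_def)
  have a: "?a \<in> carrier_vec (2 * t)" by (simp add: alternating_vec_def)
  show "kronecker_vec ?h ?a \<in> carrier_vec (2 * (2 * t))" by (rule kronecker_vec_carrier[OF h a])
  have "kronecker_vec ?h ?a $ 0 = 1"
    using t by (simp add: kronecker_vec_def hadamard_2_eigenvector_def alternating_vec_def)
  then show "kronecker_vec ?h ?a \<noteq> 0\<^sub>v (2 * (2 * t))" using t by auto
  show "kronecker_mat hadamard_2 ?K *\<^sub>v kronecker_vec ?h ?a =
    (s i * sqrt 2 * real (2 * t)) \<cdot>\<^sub>v kronecker_vec ?h ?a"
    by (rule kronecker_eigenvector[OF H K h hadamard_2_eigen[OF s[OF i]] a checkerboard_eigen])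
qed

section \<open>Graphs from extremal sign matrices\<close>

text \<open>
  By the definition of the \<open>k\<close>-th largest singular value, at least \<open>k\<close> eigenvalues have absolute
  value at least \<open>m / \<surd>k\<close>. The corresponding columns of an orthonormal eigenbasis are selected.
\<close>

lemma extremal_sign_matrix_eigenvectors:
  assumes "A \<in> extremal_sign_matrices k" "1 \<le> k"
  defines "m \<equiv> dim_row A"
  obtains v \<mu> where "orthogonal_eigenvectors m A k v \<mu>"
    "\<And>i. i < k \<Longrightarrow> real m / sqrt (real k) \<le> \<bar>\<mu> i\<bar>"
proof -
  have A: "A \<in> carrier_mat m m" "A\<^sup>T = A" and km: "k \<le> m"
    and sv: "symmetric_singular_value k A = real m / sqrt (real k)"
    using assms by (auto simp: extremal_sign_matrices_def square_mat.simps)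
  obtain U d where spec: "spectral_decomposition m A U d"
    using real_spectral_theorem[OF A] by blast
  let ?c = "real m / sqrt (real k)"
  let ?S = "{i. i < m \<and> ?c \<le> \<bar>d i\<bar>}"
  have "?c \<le> nth_largest k (image_mset (\<lambda>i. \<bar>d i\<bar>) (mset_set {..<m}))"
    using sv by (simp add: symmetric_singular_value_def
      eigenvalue_mset_spectral_decomposition[OF spec] image_mset.compositionality o_def)
  from card_ge_if_nth_largest_ge[OF assms(2) _ this] have "k \<le> card ?S"
    using km by (simp add: size_filter_spectrum)
  then obtain f where f: "f ` {..<k} \<subseteq> ?S" "inj_on f {..<k}"
    using card_le_inj[of "{..<k}" ?S] by auto
  have ev: "orthogonal_eigenvectors m A m (col U) d"
    by (rule spectral_decomposition_eigenvectors[OF spec])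
  have fm: "f i < m" "?c \<le> \<bar>d (f i)\<bar>" if "i < k" for i using f(1) that by auto
  have "f i \<noteq> f j" if "i < k" "j < k" "i \<noteq> j" for i j
    using f(2) that by (auto simp: inj_on_def)
  then have "orthogonal_eigenvectors m A k (\<lambda>i. col U (f i)) (\<lambda>i. d (f i))"
    using ev fm(1) by (auto simp: orthogonal_eigenvectors_def)
  then show ?thesis using that fm(2) by blast
qed

theorem theorem3p2:
  fixes k :: nat
  assumes "k \<ge> 1"
    and "extremal_sign_matrices k \<noteq> {}"
  shows "\<exists>n::nat. n > k \<and>
    (\<forall>t::nat. t \<ge> 1 \<longrightarrow>
      (\<exists>G :: nat pair_pre_digraph. pair_graph G \<and> graph_order G = n * t \<and>
        graph_eigenvalue (k + 1) G + graph_eigenvalue (k + 1) (complement_graph G)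
          \<ge> real (n * t) / sqrt (2 * real k) - 2 \<and>
        \<bar>graph_eigenvalue (n * t - k + 1) G\<bar>
          + \<bar>graph_eigenvalue (n * t - k + 1) (complement_graph G)\<bar>
          \<ge> real (n * t) / sqrt (2 * real k)))"
proof -
  obtain A where A_ext: "A \<in> extremal_sign_matrices k" using assms(2) by blast
  define m where "m = dim_row A"
  have A: "A \<in> carrier_mat m m" "A\<^sup>T = A" and km: "k \<le> m"
    and entries: "elements_mat A \<subseteq> {-1, 1}"
    using A_ext by (auto simp: extremal_sign_matrices_def square_mat.simps m_def sign_matrix_def)
  have A_sign: "A $$ (i, j) \<in> {-1, 1}" if "i < m" "j < m" for i j
    using elements_matI[OF A(1) that refl] entries by blast
  obtain v \<mu> where ev: "orthogonal_eigenvectors m A k v \<mu>"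
    and \<mu>: "\<And>i. i < k \<Longrightarrow> real m / sqrt (real k) \<le> \<bar>\<mu> i\<bar>"
    using extremal_sign_matrix_eigenvectors[OF A_ext assms(1)] unfolding m_def by blast
  have m: "m > 0" using km assms(1) by simp
  \<comment> \<open>The order of \<open>A\<close> is multiplied by 2 for the Hadamard factor and by 2 for the shortest vector of
      signs with sum zero.\<close>
  have "4 * m > k" using km m by simp
  moreover have "\<exists>G :: nat pair_pre_digraph. pair_graph G \<and> graph_order G = 4 * m * t \<and>
        graph_eigenvalue (k + 1) G + graph_eigenvalue (k + 1) (complement_graph G)
          \<ge> real (4 * m * t) / sqrt (2 * real k) - 2 \<and>
        \<bar>graph_eigenvalue (4 * m * t - k + 1) G\<bar>
          + \<bar>graph_eigenvalue (4 * m * t - k + 1) (complement_graph G)\<bar>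
          \<ge> real (4 * m * t) / sqrt (2 * real k)" if t: "t \<ge> 1" for t
  proof -
    let ?H = hadamard_2 and ?K = "checkerboard (2 * t)"
    define N where "N = m * (2 * (2 * t))"
    define B where "B = kronecker_mat A (kronecker_mat ?H ?K)"
    define c where "c = real N / sqrt (2 * real k)"
    have N: "4 * m * t = N" by (simp add: N_def)
    have H: "?H \<in> carrier_mat 2 2" "?H\<^sup>T = ?H" by (auto simp: hadamard_2_def intro!: eq_matI)
    have K: "?K \<in> carrier_mat (2 * t) (2 * t)" "?K\<^sup>T = ?K"
      by (auto simp: checkerboard_def add.commute intro!: eq_matI)
    note HK = kronecker_mat_carrier[OF H(1) K(1)]
    have B: "B \<in> carrier_mat N N" "B\<^sup>T = B"
      using kronecker_mat_carrier[OF A(1) HK] A(2) H(2) K(2)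
      by (auto simp: B_def N_def kronecker_mat_transpose)
    have H_sign: "?H $$ (i, j) \<in> {-1, 1}" if "i < 2" "j < 2" for i j
      using that by (auto simp: hadamard_2_def)
    have K_sign: "?K $$ (i, j) \<in> {-1, 1}" if "i < 2 * t" "j < 2 * t" for i j
      using that by (auto simp: checkerboard_def minus_one_power_iff)
    have B_sign: "B $$ (i, j) \<in> {-1, 1}" if "i < N" "j < N" for i j
      unfolding B_def
      by (rule kronecker_mat_sign[OF A(1) A_sign HK kronecker_mat_sign[OF H(1) H_sign K(1) K_sign]])
        (use that in \<open>auto simp: N_def\<close>)
    have ones: "B *\<^sub>v all_ones N = 0\<^sub>v N"
    proof -
      have c: "all_ones p \<in> carrier_vec p" for p by (simp add: all_ones_def)
      have "B *\<^sub>v all_ones N = kronecker_vec (A *\<^sub>v all_ones m)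
          (kronecker_vec (?H *\<^sub>v all_ones 2) (0\<^sub>v (2 * t)))"
        unfolding B_def N_def kronecker_all_ones[of m "2 * (2 * t)"] kronecker_all_ones[of 2 "2 * t"]
          kronecker_mat_mult_vec[OF A(1) HK c kronecker_vec_carrier[OF c c]]
          kronecker_mat_mult_vec[OF H(1) K(1) c c] checkerboard_all_ones ..
      also have "\<dots> = 0\<^sub>v N"
        by (rule eq_vecI)
          (use A H in \<open>auto simp: kronecker_vec_def N_def div_mod_less_product\<close>)
      finally show ?thesis .
    qed
    have t0: "t > 0" using t by simp
    have Npos: "N > 0" using m t0 by (simp add: N_def)
    have c: "0 < c" "c \<le> real N"
    proof -
      have "1 \<le> sqrt (2 * real k)" using assms(1) by simp
      then show "c \<le> real N" "0 < c" using Npos assms(1) by (auto simp: c_def divide_le_eq mult_le_cancel_left1)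
    qed
    \<comment> \<open>The bound \<open>m / \<surd>k\<close>, multiplied by \<open>\<surd>2\<close> from the Hadamard factor and by \<open>2 t\<close> from the
        checkerboard.\<close>
    have c_eq: "c = real m / sqrt (real k) * (sqrt 2 * real (2 * t))"
    proof -
      have "2 / sqrt 2 = sqrt 2" by (simp add: real_div_sqrt)
      have "c = (2 / sqrt 2) * (real m * real (2 * t) / sqrt (real k))"
        by (simp add: c_def N_def real_sqrt_mult)
      then show ?thesis unfolding \<open>2 / sqrt 2 = sqrt 2\<close> by simp
    qed
    define s where "s i = (if \<mu> i < 0 then - 1 else 1 :: real)" for i
    have s: "s i * s i = 1" "- s i * - s i = 1" "\<mu> i * s i = \<bar>\<mu> i\<bar>" for i by (auto simp: s_def)
    have large: "c \<le> \<bar>\<mu> i\<bar> * (sqrt 2 * real (2 * t))" if "i < k" for i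
      unfolding c_eq by (intro mult_right_mono \<mu> that) auto
    obtain u where u: "orthogonal_eigenvectors N B k u (\<lambda>i. \<mu> i * (s i * sqrt 2 * real (2 * t)))"
      using blow_up_eigenvectors[OF A(1) ev, where s = s, OF s(1) t0, folded N_def B_def] by blast
    obtain u' where u': "orthogonal_eigenvectors N B k u' (\<lambda>i. \<mu> i * (- s i * sqrt 2 * real (2 * t)))"
      using blow_up_eigenvectors[OF A(1) ev, where s = "\<lambda>i. - s i", OF s(2) t0, folded N_def B_def]
      by blast
    have pos: "c \<le> \<mu> i * (s i * sqrt 2 * real (2 * t))"
      and neg: "\<mu> i * (- s i * sqrt 2 * real (2 * t)) \<le> - c" if "i < k" for i
    proof -
      have "\<mu> i * (s i * sqrt 2 * real (2 * t)) = (\<mu> i * s i) * (sqrt 2 * real (2 * t))"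
        by (simp only: mult.assoc)
      then show "c \<le> \<mu> i * (s i * sqrt 2 * real (2 * t))"
        using large[OF that] by (simp only: s(3))
      then show "\<mu> i * (- s i * sqrt 2 * real (2 * t)) \<le> - c" by simp
    qed
    note bounds = sign_graph_eigenvalue_bounds[OF B B_sign ones assms(1) c u pos u' neg]
    have mB: "- B \<in> carrier_mat N N" "(- B)\<^sup>T = - B"
      using B by (auto simp: transpose_uminus)
    have mB_sign: "(- B) $$ (i, j) \<in> {-1, 1}" if "i < N" "j < N" for i j
      using B_sign[OF that] B(1) that by auto
    have mB_ones: "- B *\<^sub>v all_ones N = 0\<^sub>v N"
      using ones B(1) by (simp add: all_ones_def)
    \<comment> \<open>Negating \<open>B\<close> exchanges the two families of eigenvectors.\<close>
    note bounds' = sign_graph_eigenvalue_bounds[OF mB mB_sign mB_ones assms(1) c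
        orthogonal_eigenvectors_uminus[OF u' B(1)] _ orthogonal_eigenvectors_uminus[OF u B(1)]]
    have low': "c / 2 - 1 \<le> graph_eigenvalue (k + 1) (sign_graph N (- B))"
      by (rule bounds'(1)) (use pos neg in force)+
    have up': "graph_eigenvalue (N - k + 1) (sign_graph N (- B)) \<le> - (c / 2)"
      by (rule bounds'(2)) (use pos neg in force)+
    have "graph_order (sign_graph N B) = N" by (simp add: graph_order_def sign_graph_def)
    then show ?thesis
      unfolding N c_def[symmetric]
      using pair_graph_sign_graph[OF B] complement_sign_graph[OF B(1) B_sign] bounds low' up'
      by (intro exI[of _ "sign_graph N B"]) auto
  qed
  ultimately show ?thesis by blast
qed

end
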